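(* Let $\mathcal{A}$ be a translation KM-arc of type $2^i$ in $\mathrm{PG}(2,2^h)$ with translation line $\ell$. Then $\mathcal{A}$ can be constructed as follows: with $\mathcal{D}$ the Desarguesian $(h-1)$-spread of $\mathrm{PG}(3h-1,2)$ obtained by field reduction from $\mathrm{PG}(2,2^h)$ and $H$ the $(2h-1)$-space with $\mathcal{B}(H)=\ell$, there exist an $(h-1)$-dimensional subspace $\mu\subseteq H$ such that $\mathcal{C}=\mathcal{B}(\mu)$ is an $i$-club of rank $h$ whose head $N$ lies on $\ell$, and an $h$-dimensional subspace $\pi$ with $\pi\cap H=\mu$, such that $\mathcal{A}=(\mathcal{B}(\pi)\setminus\mathcal{C})\cup(\ell\setminus\mathcal{C})$ (and then $N$ is the $2^i$-nucleus of $\mathcal{A}$).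
   Context: Field reduction: $\mathbb{F}_{2^h}^3$ regarded over $\mathbb{F}_2$ defines $\mathrm{PG}(3h-1,2)$; each point $\langle v\rangle_{\mathbb{F}_{2^h}}$ of $\mathrm{PG}(2,2^h)$ corresponds to the $(h-1)$-dimensional subspace of $\mathrm{PG}(3h-1,2)$ formed by the nonzero elements of $\{\lambda v:\lambda\in\mathbb{F}_{2^h}\}$; these form the Desarguesian spread $\mathcal{D}$. For $U\subseteq\mathrm{PG}(3h-1,2)$, $\mathcal{B}(U)$ is the set of points of $\mathrm{PG}(2,2^h)$ whose spread element meets $U$. For a projective subspace $\mu$ of dimension $k-1$, $\mathcal{B}(\mu)$ is an $\mathbb{F}_2$-linear set of rank $k$; the weight of a point $\mathcal{B}(p)$ of $\mathcal{B}(\mu)$ is $\dim(\mu\cap p)+1$. An $i$-club of rank $k$ is a linear set of rank $k$ with one point (the head) of weight $i$ and all other points of weight $1$. A KM-arc of type $t$ in $\mathrm{PG}(2,q)$ is a set of $q+t$ points such that every line meets it in $0$, $2$ or $t$ points, each value occurring; its $t$-nucleus is the common point of its $t$-secants. A set $S$ is a translation set with respect to the line $\ell$ (translation line) if the group of elations with axis $\ell$ fixing $S$ acts transitively on $S\setminus\ell$; a translation KM-arc is a KM-arc that is a translation set.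
   Formalization: Assumes i ≥ 1 (translation ovals refute i = 0) and, if i = h, that ℓ meets 𝒜 (else two lines minus their common point N, with ℓ external through N, refute it); N is claimed to be the 2^i-nucleus only for i > 1, since the 2-secants of a hyperoval have no common point. *)

theory Defs
  imports "HOL-Analysis.Cartesian_Space" "HOL-Library.Z2" "HOL-Combinatorics.Permutations"
begin

text \<open>
  The plane \<open>PG(2,q)\<close> over a finite field \<^typ>\<open>'a\<close>: a point is a one-dimensional subspace of
  \<open>'a^3\<close> (a set of vectors, containing \<open>0\<close>), a line is a set of points.
\<close>

definition pg_points :: "('a::field ^ 3) set set" where
  "pg_points = {P. vec.subspace P \<and> vec.dim P = 1}"

definition pg_lines :: "('a::field ^ 3) set set set" where
  "pg_lines = {{P \<in> pg_points. P \<subseteq> V} | V. vec.subspace V \<and> vec.dim V = 2}"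

definition collineation :: "(('a::field ^ 3) set \<Rightarrow> ('a ^ 3) set) \<Rightarrow> bool" where
  "collineation \<phi> \<longleftrightarrow> \<phi> permutes pg_points \<and> (\<forall>L. L \<in> pg_lines \<longrightarrow> \<phi> ` L \<in> pg_lines)"

text \<open>Elations with axis \<open>l\<close>, the centre ranging over the points of \<open>l\<close>; the identity is one of them.\<close>

definition elations :: "('a::field ^ 3) set set \<Rightarrow> (('a ^ 3) set \<Rightarrow> ('a ^ 3) set) set" where
  "elations l = {\<phi>. collineation \<phi> \<and> (\<forall>P\<in>l. \<phi> P = P) \<and>
     (\<exists>C\<in>l. \<forall>L\<in>pg_lines. C \<in> L \<longrightarrow> \<phi> ` L = L)}"

definition translation_set :: "('a::field ^ 3) set set \<Rightarrow> ('a ^ 3) set set \<Rightarrow> bool" where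
  "translation_set l S \<longleftrightarrow> l \<in> pg_lines \<and> S \<subseteq> pg_points \<and>
     (\<forall>P\<in>S - l. \<forall>Q\<in>S - l. \<exists>\<phi>\<in>elations l. \<phi> ` S = S \<and> \<phi> P = Q)"

definition km_arc :: "nat \<Rightarrow> ('a::{field,finite} ^ 3) set set \<Rightarrow> bool" where
  "km_arc t A \<longleftrightarrow> A \<subseteq> pg_points \<and> card A = CARD('a) + t \<and>
     (\<forall>L\<in>pg_lines. card (A \<inter> L) \<in> {0, 2, t}) \<and>
     (\<forall>n\<in>{0, 2, t}. \<exists>L\<in>pg_lines. card (A \<inter> L) = n)"

text \<open>
  \<open>N\<close> is the only point common to all \<open>t\<close>-secants. A KM-arc of type 2 (a hyperoval) has no such
  point.
\<close>

definition is_nucleus :: "nat \<Rightarrow> ('a::field ^ 3) set set \<Rightarrow> ('a ^ 3) set \<Rightarrow> bool" where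
  "is_nucleus t A N \<longleftrightarrow>
     {P \<in> pg_points. \<forall>L\<in>pg_lines. card (A \<inter> L) = t \<longrightarrow> P \<in> L} = {N}"

text \<open>
  Field reduction: \<open>'a^3\<close> as a vector space over the two-element field \<^typ>\<open>bit\<close>, which is meaningful
  when \<^typ>\<open>'a\<close> has characteristic 2. Points of \<open>PG(3h-1,2)\<close> are identified with the nonzero
  vectors, and a projective subspace of dimension \<open>k - 1\<close> is represented by the underlying
  \<open>bit\<close>-subspace of dimension \<open>k\<close>, zero vector included.
\<close>

definition f2_scale :: "bit \<Rightarrow> 'a::field ^ 3 \<Rightarrow> 'a ^ 3" where
  "f2_scale c v = (if c = 1 then v else 0)"

abbreviation f2_dim :: "('a::field ^ 3) set \<Rightarrow> nat" where
  "f2_dim \<equiv> vector_space.dim f2_scale"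

definition f2_subspace_of_rank :: "nat \<Rightarrow> ('a::field ^ 3) set \<Rightarrow> bool" where
  "f2_subspace_of_rank k U \<longleftrightarrow> module.subspace f2_scale U \<and> f2_dim U = k"

lemma vector_space_f2_scale:
  assumes "CARD('a::{field,finite}) = 2 ^ h"
  shows "vector_space (f2_scale :: bit \<Rightarrow> 'a ^ 3 \<Rightarrow> 'a ^ 3)"
proof -
  have "(\<Sum>x\<in>UNIV. x + 1) = (\<Sum>x\<in>UNIV. x :: 'a)"
    by (rule sum.reindex_bij_witness[of _ "\<lambda>x. x - 1" "\<lambda>x. x + 1"]) auto
  hence "(of_nat (CARD('a)) :: 'a) = 0"
    by (simp add: sum.distrib)
  hence two: "(1::'a) + 1 = 0"
    using assms by simp
  have dbl: "v + v = 0" for v :: "'a ^ 3"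
  proof -
    have "v $ j + v $ j = (1 + 1) * v $ j" for j
      by (simp only: distrib_right mult_1)
    thus ?thesis using two by (simp add: vec_eq_iff)
  qed
  show ?thesis
    by unfold_locales (auto simp: f2_scale_def dbl plus_bit_def)
qed

text \<open>
  The Desarguesian spread element of the point \<open>\<langle>v\<rangle>\<close> is the \<open>bit\<close>-subspace \<open>{\<lambda>v}\<close>, which as a set of
  vectors is the point itself. So the spread is \<^const>\<open>pg_points\<close>, a spread element \<open>P\<close>
  meets \<open>U\<close> when they share a nonzero vector, and \<open>dim (\<mu> \<inter> P) + 1\<close> is the vector space dimension
  of \<open>\<mu> \<inter> P\<close> over \<^typ>\<open>bit\<close>.
\<close>

definition \<B> :: "('a::field ^ 3) set \<Rightarrow> ('a ^ 3) set set" where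
  "\<B> U = {P \<in> pg_points. \<exists>v\<in>P \<inter> U. v \<noteq> 0}"

definition weight :: "('a::field ^ 3) set \<Rightarrow> ('a ^ 3) set \<Rightarrow> nat" where
  "weight \<mu> P = f2_dim (\<mu> \<inter> P)"

text \<open>The linear set \<open>\<B> \<mu>\<close> is an \<open>i\<close>-club of rank \<open>k\<close> with head \<open>N\<close>; weights refer to \<open>\<mu>\<close>.\<close>

definition is_club :: "nat \<Rightarrow> nat \<Rightarrow> ('a::field ^ 3) set \<Rightarrow> ('a ^ 3) set \<Rightarrow> bool" where
  "is_club i k \<mu> N \<longleftrightarrow> f2_subspace_of_rank k \<mu> \<and> N \<in> \<B> \<mu> \<and> weight \<mu> N = i \<and>
     (\<forall>P\<in>\<B> \<mu> - {N}. weight \<mu> P = 1)"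

text \<open>The projective dimensions of \<open>H\<close>, \<open>\<mu>\<close>, \<open>\<pi>\<close> are \<open>2h - 1\<close>, \<open>h - 1\<close>, \<open>h\<close>.\<close>

definition club_construction ::
  "nat \<Rightarrow> nat \<Rightarrow> ('a::field ^ 3) set set \<Rightarrow> ('a ^ 3) set \<Rightarrow> ('a ^ 3) set \<Rightarrow> ('a ^ 3) set \<Rightarrow>
   ('a ^ 3) set \<Rightarrow> ('a ^ 3) set set \<Rightarrow> bool" where
  "club_construction h i l H \<mu> N \<pi> A \<longleftrightarrow>
     f2_subspace_of_rank (2 * h) H \<and> \<B> H = l \<and>
     \<mu> \<subseteq> H \<and> is_club i h \<mu> N \<and> N \<in> l \<and>
     f2_subspace_of_rank (h + 1) \<pi> \<and> \<pi> \<inter> H = \<mu> \<and>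
     A = (\<B> \<pi> - \<B> \<mu>) \<union> (l - \<B> \<mu>)"

end

theory Submission
  imports Defs
begin

text \<open>
  Let \<open>V\<close> be the two-dimensional subspace underlying \<open>l\<close>, and \<open>\<langle>u\<rangle>\<close> a point of \<open>A\<close> off \<open>l\<close>.
  The points off \<open>l\<close> are the \<open>\<langle>u + v\<rangle>\<close> with \<open>v \<in> V\<close>, and the elations with axis \<open>l\<close> act on them as
  translations \<open>v \<mapsto> v + w\<close>. Transitivity on \<open>A - l\<close> therefore says that
  \<open>T = {v \<in> V. \<langle>u + v\<rangle> \<in> A}\<close> is an additive group, that is an \<open>\<F>\<^sub>2\<close>-subspace, and one takes \<open>\<mu> = T\<close>
  and \<open>\<pi> = T \<union> (u + T)\<close>. As \<open>|T| = q + 2^i - |A \<inter> l|\<close> is a power of two, \<open>|A \<inter> l| = 2^i\<close> and \<open>|T| = q\<close>.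
  For a point \<open>P\<close> of \<open>l\<close>, the line joining \<open>P\<close> and \<open>\<langle>u\<rangle>\<close> contains \<open>|T \<inter> P| = 2^w\<close> points of \<open>A - l\<close>. By
  parity \<open>P\<close> lies in \<open>A\<close> iff \<open>w = 0\<close>, and otherwise \<open>w\<close> is \<open>1\<close> or \<open>i\<close>. Counting the nonzero vectors of \<open>T\<close>
  point by point shows that the weight \<open>i\<close> occurs once (for \<open>i > 1\<close>), so \<open>\<B> T\<close> is an \<open>i\<close>-club.
  Conversely, the same line count in a given construction leaves only lines through the head as
  possible \<open>2^i\<close>-secants.
\<close>

section \<open>Orders of subspaces, and the structure over \<open>bit\<close>\<close>

lemma (in vector_space) card_span_independent:
  assumes "finite (UNIV :: 'a set)" and "finite B" and "independent B"
  shows "finite (span B) \<and> card (span B) = CARD('a) ^ card B"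
  using assms(2,3)
proof (induction B)
  case empty
  show ?case by simp
next
  case (insert b B)
  hence ind: "independent B" and b: "b \<notin> span B"
    by (auto simp: independent_insert)
  let ?f = "\<lambda>(k :: 'a, v). scale k b + v"
  have bij: "bij_betw ?f (UNIV \<times> span B) (span (insert b B))"
  proof (rule bij_betwI')
    fix x y :: "'a \<times> 'b" assume "x \<in> UNIV \<times> span B" "y \<in> UNIV \<times> span B"
    then obtain k v l w where xy: "x = (k, v)" "y = (l, w)" and vw: "v \<in> span B" "w \<in> span B"
      by auto
    show "(?f x = ?f y) = (x = y)"
    proof
      assume eq: "?f x = ?f y"
      hence "scale k b + v = scale l b + w" by (simp add: xy)
      hence "scale (k - l) b = w - v"
        unfolding scale_left_diff_distrib by (metis add_diff_cancel diff_diff_eq2 add.commute)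
      hence "scale (k - l) b \<in> span B"
        using vw by (simp add: span_diff)
      hence "k - l = 0"
        using b span_scale[of "scale (k - l) b" B "inverse (k - l)"] by (cases "k - l = 0") auto
      thus "x = y" using eq xy by simp
    qed simp
  next
    fix x :: "'a \<times> 'b" assume "x \<in> UNIV \<times> span B"
    thus "?f x \<in> span (insert b B)"
      by (auto simp: intro: span_add span_scale span_base span_mono[THEN subsetD, OF subset_insertI])
  next
    fix y assume "y \<in> span (insert b B)"
    then obtain k where "y - scale k b \<in> span B"
      by (auto simp: span_insert)
    thus "\<exists>x\<in>UNIV \<times> span B. y = ?f x"
      by (intro bexI[of _ "(k, y - scale k b)"]) auto
  qed
  have "finite (span (insert b B))"
    using bij bij_betw_finite insert.IH[OF ind] assms(1) by blast
  moreover have "card (span (insert b B)) = CARD('a) * CARD('a) ^ card B"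
    using bij_betw_same_card[OF bij] insert.IH[OF ind] by (simp add: card_cartesian_product)
  ultimately show ?case
    using insert.hyps by simp
qed

text \<open>Serves over two fields: over \<open>bit\<close> it turns ranks and weights into powers
  of two, over the field of the plane it gives the orders of \<open>V\<close> and of a single
  point.\<close>

lemma (in vector_space) card_subspace:
  assumes "finite (UNIV :: 'a set)" and "finite S" and "subspace S"
  shows "card S = CARD('a) ^ dim S"
proof -
  obtain B where B: "B \<subseteq> S" "independent B" "S \<subseteq> span B" "card B = dim S"
    using basis_exists by blast
  have "span B = S"
    using B assms(3) span_minimal by blast
  thus ?thesis
    using card_span_independent[OF assms(1) _ B(2)] B(1,4) assms(2) finite_subset by metis
qed

lemma finite_UNIV_bit: "finite (UNIV :: bit set)" and CARD_bit: "CARD(bit) = 2"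
proof -
  have "(UNIV :: bit set) = {0, 1}"
    using bit.exhaust by auto
  thus "finite (UNIV :: bit set)" and "CARD(bit) = 2"
    by (metis finite.emptyI finite.insertI, metis card_2_iff zero_neq_one)
qed

lemma char_two:
  assumes "CARD('a::{field,finite}) = 2 ^ h"
  shows "(x :: 'a ^ 3) + x = 0"
proof -
  interpret f2: vector_space "f2_scale :: bit \<Rightarrow> 'a ^ 3 \<Rightarrow> 'a ^ 3"
    by (rule vector_space_f2_scale[OF assms])
  show ?thesis
    using f2.scale_left_distrib[of 1 1 x] by (simp add: f2_scale_def)
qed

lemma char_two_minus:
  assumes "CARD('a::{field,finite}) = 2 ^ h"
  shows "(x :: 'a ^ 3) - y = x + y"
proof -
  have "- y = y" using char_two[OF assms, of y] by (rule minus_unique)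
  thus ?thesis by (metis diff_conv_add_uminus)
qed

text \<open>The only scalars are 0 and 1, and in characteristic 2 subtraction is addition. Closure
  under differences is the form in which transitivity of the elations delivers the group.\<close>

lemma f2_subspace_iff:
  assumes "CARD('a::{field,finite}) = 2 ^ h"
  shows "module.subspace f2_scale (U :: ('a ^ 3) set) \<longleftrightarrow> 0 \<in> U \<and> (\<forall>x\<in>U. \<forall>y\<in>U. x - y \<in> U)"
proof -
  interpret f2: vector_space "f2_scale :: bit \<Rightarrow> 'a ^ 3 \<Rightarrow> 'a ^ 3"
    by (rule vector_space_f2_scale[OF assms])
  show ?thesis
    unfolding f2.subspace_def by (auto simp: f2_scale_def char_two_minus[OF assms])
qed

lemma card_f2_subspace:
  assumes "CARD('a::{field,finite}) = 2 ^ h" and "module.subspace f2_scale (U :: ('a ^ 3) set)"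
  shows "card U = 2 ^ f2_dim U"
proof -
  interpret f2: vector_space "f2_scale :: bit \<Rightarrow> 'a ^ 3 \<Rightarrow> 'a ^ 3"
    by (rule vector_space_f2_scale[OF assms(1)])
  show ?thesis
    using f2.card_subspace[OF finite_UNIV_bit _ assms(2)] by (simp add: CARD_bit)
qed

lemma card_eq_power_weight:
  fixes T :: "('a::{field,finite} ^ 3) set"
  assumes q: "CARD('a) = 2 ^ h"
    and T: "0 \<in> T" "\<And>x y. x \<in> T \<Longrightarrow> y \<in> T \<Longrightarrow> x - y \<in> T" and P: "P \<in> pg_points"
  shows "card (T \<inter> P) = 2 ^ weight T P"
proof -
  have "module.subspace f2_scale (T \<inter> P)"
    unfolding f2_subspace_iff[OF q] using P T
    by (auto simp: pg_points_def vec.subspace_0 vec.subspace_diff)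
  thus ?thesis unfolding weight_def by (rule card_f2_subspace[OF q])
qed

lemma f2_subspace_of_rank_iff:
  assumes "CARD('a::{field,finite}) = 2 ^ h"
  shows "f2_subspace_of_rank k (U :: ('a ^ 3) set) \<longleftrightarrow> module.subspace f2_scale U \<and> card U = 2 ^ k"
  using card_f2_subspace[OF assms, of U] by (auto simp: f2_subspace_of_rank_def)

section \<open>Points and lines of the plane as spans\<close>

abbreviation pt :: "'a::field ^ 3 \<Rightarrow> ('a ^ 3) set" where
  "pt x \<equiv> vec.span {x}"

definition pline :: "('a::field ^ 3) set \<Rightarrow> ('a ^ 3) set set" where
  "pline W = {P \<in> pg_points. P \<subseteq> W}"

lemma pg_lines_iff: "L \<in> pg_lines \<longleftrightarrow> (\<exists>W. L = pline W \<and> vec.subspace W \<and> vec.dim W = 2)"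
  by (auto simp: pg_lines_def pline_def)

lemma in_pt_iff: "y \<in> pt x \<longleftrightarrow> (\<exists>k. y = k *s x)"
  by (auto simp: vec.span_singleton)

lemma pt_subset_iff: "vec.subspace W \<Longrightarrow> pt x \<subseteq> W \<longleftrightarrow> x \<in> W"
  using vec.span_minimal[of "{x}" W] vec.span_base[of x "{x}"] by auto

lemma pt_in_pg_points: "x \<noteq> 0 \<Longrightarrow> pt x \<in> pg_points"
  by (simp add: pg_points_def)

lemma pt_eqI: "P \<in> pg_points \<Longrightarrow> x \<in> P \<Longrightarrow> x \<noteq> 0 \<Longrightarrow> pt x = P"
  using vec.subspace_dim_equal[of "pt x" P] by (simp add: pg_points_def pt_subset_iff)

lemma pg_point_obtain:
  assumes "P \<in> pg_points" obtains x where "x \<noteq> 0" "P = pt x"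
proof -
  have "\<not> P \<subseteq> {0}"
    using assms vec.dim_eq_0[of P] by (auto simp: pg_points_def)
  thus ?thesis
    using that pt_eqI[OF assms, symmetric] by auto
qed

lemma pt_in_pline_iff: "vec.subspace W \<Longrightarrow> x \<noteq> 0 \<Longrightarrow> pt x \<in> pline W \<longleftrightarrow> x \<in> W"
  by (simp add: pline_def pt_in_pg_points pt_subset_iff)

lemma pt_eq_iff: "x \<noteq> 0 \<Longrightarrow> y \<noteq> 0 \<Longrightarrow> pt x = pt y \<longleftrightarrow> x \<in> pt y"
  using pt_eqI[OF pt_in_pg_points, of y x] vec.span_base[of x "{x}"] by auto

text \<open>Meant for \<open>d\<close> points of the arc on the translation line and
  \<open>2 ^ k\<close> off it. The value 0 fails by size, and 2 fails modulo 4 unless it equals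
  \<open>2 ^ i\<close>. For \<open>i = h\<close> the value 0 would solve the equation with
  \<open>k = h + 1\<close>, which is why that case is excluded.\<close>

lemma power_of_two_partition:
  fixes d h i k :: nat
  assumes eq: "(2::nat) ^ h + 2 ^ i = 2 ^ k + d" and d: "d \<in> {0, 2, 2 ^ i}"
    and i: "1 \<le> i" "i \<le> h" and ih: "i = h \<Longrightarrow> d \<noteq> 0"
  shows "d = 2 ^ i \<and> k = h"
proof (cases "d = 2 ^ i")
  case True
  thus ?thesis using eq by simp
next
  case False
  show ?thesis
  proof (cases "d = 0")
    \<comment> \<open>\<open>2^h + 2^i\<close> lies strictly between \<open>2^h\<close> and \<open>2^(h+1)\<close>\<close>
    case True
    hence "i < h" using ih i(2) by (cases "i = h") auto
    hence "(2::nat) ^ h < 2 ^ h + 2 ^ i" "(2::nat) ^ h + 2 ^ i < 2 ^ Suc h"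
      using True power_strict_increasing[of i h "2::nat"] by simp_all
    hence "h < k" "k < Suc h"
      unfolding eq True add_0_right by (metis power_less_imp_less_exp one_less_numeral_iff semiring_norm(76))+
    thus ?thesis by simp
  next
    case nz: False
    hence d2: "d = 2" and i2: "2 \<le> i" using d False i(1) by (auto simp: le_less Suc_le_eq)
    have dv: "4 dvd (2::nat) ^ m" if "2 \<le> m" for m
      using le_imp_power_dvd[OF that, of "2::nat"] by simp
    \<comment> \<open>For smaller \<open>k\<close> the right side is at most 4, whereas the left
      side is at least 8.\<close>
    have "2 \<le> k"
    proof (rule ccontr)
      assume "\<not> 2 \<le> k"
      hence "k = 0 \<or> k = 1" by auto
      hence "(2::nat) ^ h + 2 ^ i \<le> 4" using eq d2 by auto
      moreover have "(2::nat) ^ 2 \<le> 2 ^ h" "(2::nat) ^ 2 \<le> 2 ^ i"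
        using i2 i(2) by (simp_all only: power_increasing[of 2 _ "2::nat"] one_le_numeral le_trans[of 2 i h])
      ultimately show False by simp
    qed
    hence "4 dvd (2::nat) ^ k" "4 dvd (2::nat) ^ h + 2 ^ i"
      using dv i2 i(2) by (auto intro: dvd_add)
    hence "4 dvd d" using eq by (metis dvd_add_right_iff)
    thus ?thesis using d2 by simp
  qed
qed

lemma two_points_line:
  assumes "vec.subspace W" "vec.dim W = 2" "vec.subspace W'" "vec.dim W' = 2" "P \<noteq> Q"
    and "P \<in> pline W" "P \<in> pline W'" "Q \<in> pline W" "Q \<in> pline W'"
  shows "pline W = pline W'"
proof -
  have PQ: "P \<in> pg_points" "Q \<in> pg_points" using assms(6,8) by (auto simp: pline_def)
  obtain x where x: "x \<noteq> 0" "P = pt x" using pg_point_obtain[OF PQ(1)] .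
  obtain y where y: "y \<noteq> 0" "Q = pt y" using pg_point_obtain[OF PQ(2)] .
  note xy = x y
  have "x \<notin> pt y" using assms(5) xy pt_eq_iff[of x y] by simp
  hence dim: "vec.dim {x, y} = 2" using xy(3) by (simp add: vec.dim_insert)
  have "vec.span {x, y} = U" if "vec.subspace U" "vec.dim U = 2" "x \<in> U" "y \<in> U" for U
    using that dim by (intro vec.subspace_dim_equal vec.span_minimal) auto
  from this[OF assms(1,2)] this[OF assms(3,4)] show ?thesis
    using assms(1,3,6-9) xy by (simp add: pt_in_pline_iff)
qed

section \<open>Affine coordinates with respect to the line of \<open>V\<close>\<close>

locale plane_line =
  fixes V :: "('a::{field,finite} ^ 3) set"
  assumes sub: "vec.subspace V" and dim2: "vec.dim V = 2"
begin

lemma line: "pline V \<in> pg_lines"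
  using sub dim2 by (auto simp: pg_lines_iff)

lemma V_props: "0 \<in> V" "x \<in> V \<Longrightarrow> y \<in> V \<Longrightarrow> x + y \<in> V" "x \<in> V \<Longrightarrow> y \<in> V \<Longrightarrow> x - y \<in> V"
  "x \<in> V \<Longrightarrow> k *s x \<in> V"
  using sub by (auto simp: vec.subspace_0 vec.subspace_add vec.subspace_diff vec.subspace_scale)

lemma affine_notin: "p \<notin> V \<Longrightarrow> v \<in> V \<Longrightarrow> p + v \<notin> V"
  using V_props(3)[of "p + v" v] by auto

text \<open>\<open>V\<close> is a hyperplane, so the class of any outside vector \<open>x\<close>
  spans the quotient by \<open>V\<close>.\<close>

lemma decomposition:
  assumes "x \<notin> V"
  shows "\<exists>a. z - a *s x \<in> V"
proof -
  have "vec.dim (vec.span (insert x V)) = vec.dim (UNIV :: ('a ^ 3) set)"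
    using assms sub dim2 by (simp only: vec.dim_span vec.dim_insert vec.span_eq_iff[THEN iffD2] vec_dim_card) simp
  hence "vec.span (insert x V) = UNIV"
    by (intro vec.subspace_dim_equal) auto
  hence "z \<in> vec.span (insert x V)" by simp
  thus ?thesis
    using sub by (simp add: vec.span_insert vec.span_eq_iff[THEN iffD2])
qed

lemma scale_in_iff: "x \<notin> V \<Longrightarrow> a *s x \<in> V \<longleftrightarrow> a = 0"
  using V_props(4)[of "a *s x" "inverse a"] V_props(1) by (cases "a = 0") auto

text \<open>Coefficients of \<open>x\<close> are compared modulo \<open>V\<close>. This normalises
  to 1 the coefficient \<open>b\<close> of any \<open>a *s v + b *s x\<close> with \<open>v\<close>
  in \<open>V\<close> that lies in the coset \<open>x + V\<close>.\<close>

lemma affine_coefficient: "x \<notin> V \<Longrightarrow> a *s x - x \<in> V \<Longrightarrow> a = 1"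
  using scale_in_iff[of x "a - 1"] by (simp add: vec.scale_left_diff_distrib)

lemma affine_inj: "x \<notin> V \<Longrightarrow> y - x \<in> V \<Longrightarrow> y \<in> pt x \<Longrightarrow> y = x"
  using affine_coefficient by (metis in_pt_iff vector_smult_lid)

text \<open>A vector spanning \<open>P\<close> lies outside \<open>V\<close>, so some multiple of it
  falls into the coset \<open>x + V\<close>. Together with \<open>affine_pt_inj\<close> this
  identifies the points off the line with the vectors of \<open>V\<close>.\<close>

lemma affine_point:
  assumes "P \<in> pg_points" "P \<notin> pline V" "x \<notin> V"
  shows "\<exists>v\<in>V. P = pt (x + v)"
proof -
  obtain z where z: "z \<noteq> 0" "P = pt z"
    using pg_point_obtain assms(1) by blast
  hence zV: "z \<notin> V"
    using assms(2) pt_in_pline_iff sub by blast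
  obtain a where a: "x - a *s z \<in> V"
    using decomposition[OF zV] by blast
  have a0: "a \<noteq> 0" using a assms(3) by auto
  have "pt (a *s z) = P"
    using z a0 by (intro pt_eqI[OF assms(1)]) (auto simp: in_pt_iff)
  moreover have "a *s z = x + (- (x - a *s z))" by simp
  moreover have "- (x - a *s z) \<in> V" using a sub by (rule vec.subspace_neg[rotated])
  ultimately show ?thesis by metis
qed

lemma affine_pt_inj:
  assumes "x \<notin> V" "v \<in> V" "w \<in> V" "pt (x + v) = pt (x + w)"
  shows "v = w"
proof -
  have "x + v \<in> pt (x + w)" using assms(4) vec.span_base by blast
  thus ?thesis
    using affine_inj[of "x + w" "x + v"] affine_notin[OF assms(1,3)] V_props(3)[OF assms(2,3)] by simp
qed

lemma affine_pt_notin: "x \<notin> V \<Longrightarrow> v \<in> V \<Longrightarrow> pt (x + v) \<notin> pline V"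
  using affine_notin[of x v] by (auto simp: pline_def pt_subset_iff[OF sub])

lemma affine_pt: "x \<notin> V \<Longrightarrow> v \<in> V \<Longrightarrow> pt (x + v) \<in> pg_points"
  using affine_notin[of x v] V_props(1) by (intro pt_in_pg_points) auto

section \<open>Joining lines, and elations as translations\<close>

lemma dim_join:
  assumes "v \<in> V" "v \<noteq> 0" "x \<notin> V"
  shows "vec.dim (vec.span {v, x}) = 2"
proof -
  have "v \<notin> pt x"
    using assms V_props(4) scale_in_iff by (auto simp: in_pt_iff)
  moreover have "x \<noteq> 0" using assms(3) V_props(1) by blast
  ultimately show ?thesis
    by (simp add: vec.dim_insert)
qed

lemma in_join_iff: "z \<in> vec.span {v, x} \<longleftrightarrow> (\<exists>a b. z = a *s v + b *s x)"
  by (auto simp: vec.span_insert vec.span_singleton diff_eq_eq add.commute)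

text \<open>Lines through the centre \<open>pt c\<close> are fixed, so each affine point moves by
  some multiple of \<open>c\<close>; the pointwise fixed axis makes this multiple constant on
  \<open>p + V\<close>. Only incidence is used, so no matrix or semilinear form of the collineation
  is needed.\<close>

lemma elation_translation:
  assumes \<phi>: "\<phi> \<in> elations (pline V)" and p: "p \<notin> V"
  shows "\<exists>w\<in>V. \<forall>v\<in>V. \<phi> (pt (p + v)) = pt (p + v + w)"
proof -
  obtain C where col: "collineation \<phi>" and fix_l: "\<And>P. P \<in> pline V \<Longrightarrow> \<phi> P = P" and C: "C \<in> pline V"
    and fix_C: "\<And>L. L \<in> pg_lines \<Longrightarrow> C \<in> L \<Longrightarrow> \<phi> ` L = L"
    using \<phi> by (auto simp: elations_def)
  have perm: "\<phi> permutes pg_points" and lines: "\<And>L. L \<in> pg_lines \<Longrightarrow> \<phi> ` L \<in> pg_lines"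
    using col by (auto simp: collineation_def)
  obtain c where c: "c \<noteq> 0" "C = pt c"
    using C pg_point_obtain by (auto simp: pline_def)
  have cV: "c \<in> V" using c C pt_in_pline_iff sub by blast
  have "\<exists>k. \<phi> (pt x) = pt (x + k *s c)" if x: "x \<notin> V" for x
  proof -
    let ?W = "vec.span {c, x}"
    have x0: "x \<noteq> 0" using x V_props(1) by blast
    have L: "pline ?W \<in> pg_lines" "C \<in> pline ?W" "pt x \<in> pline ?W"
      using c x0 dim_join[OF cV c(1) x] by (auto simp: pg_lines_iff pt_in_pline_iff intro: vec.span_base)
    have im: "\<phi> (pt x) \<in> pline ?W" using fix_C[OF L(1,2)] L(3) by blast
    have off: "\<phi> (pt x) \<notin> pline V"
    proof
      assume "\<phi> (pt x) \<in> pline V"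
      hence "pt x \<in> pline V" using fix_l permutes_inj[OF perm] by (metis injD)
      thus False using x x0 sub pt_in_pline_iff by blast
    qed
    obtain v where v: "v \<in> V" "\<phi> (pt x) = pt (x + v)"
      using affine_point[OF _ off x] im by (auto simp: pline_def)
    have "x + v \<in> ?W"
      using im v by (simp add: pline_def pt_subset_iff)
    then obtain a b where ab: "x + v = a *s c + b *s x"
      by (auto simp: in_join_iff)
    have "b *s x - x = v - a *s c" using ab by (simp add: algebra_simps)
    also have "\<dots> \<in> V" using v(1) cV by (intro V_props(3,4))
    finally have "b = 1" by (rule affine_coefficient[OF x])
    hence "v = a *s c" using ab by simp
    thus ?thesis using v by auto
  qed
  \<comment> \<open>\<open>k\<close> is constant on the coset \<open>p + V\<close>: the line joining \<open>x\<close> and \<open>x + v\<close> meets \<open>l\<close> in the fixed point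
    \<open>\<langle>v\<rangle>\<close>, so its image would contain \<open>c\<close> if \<open>k x \<noteq> k (x + v)\<close>. Directions \<open>v\<close> along \<open>c\<close> are reached in two
    steps.\<close>
  then obtain k where k: "\<And>x. x \<notin> V \<Longrightarrow> \<phi> (pt x) = pt (x + k x *s c)" by metis
  have step: "k (x + v) = k x" if x: "x \<notin> V" and v: "v \<in> V" "v \<notin> pt c" for x v
  proof (rule ccontr)
    assume ne: "k (x + v) \<noteq> k x"
    have v0: "v \<noteq> 0" using v(2) vec.span_zero by metis
    let ?W = "vec.span {v, x}"
    have x0: "x \<noteq> 0" "x + v \<noteq> 0" using x V_props(1) affine_notin[OF x v(1)] by auto
    have xv: "x + v \<in> ?W" by (simp add: vec.span_add vec.span_base)
    have "pline ?W \<in> pg_lines"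
      using dim_join[OF v(1) v0 x] by (auto simp: pg_lines_iff)
    from lines[OF this] obtain W where W: "\<phi> ` pline ?W = pline W" "vec.subspace W" "vec.dim W = 2"
      by (auto simp: pg_lines_iff)
    have "pt v \<in> pline ?W" "pt x \<in> pline ?W" "pt (x + v) \<in> pline ?W"
      using v0 x0 xv by (simp_all add: pt_in_pline_iff vec.span_base)
    hence "\<phi> (pt v) \<in> pline W" "\<phi> (pt x) \<in> pline W" "\<phi> (pt (x + v)) \<in> pline W"
      using W(1) by blast+
    moreover have "\<phi> (pt v) = pt v"
      using fix_l v(1) v0 sub by (simp add: pt_in_pline_iff)
    moreover note k[OF x] k[OF affine_notin[OF x v(1)]]
    ultimately have mem: "v \<in> W" "x + k x *s c \<in> W" "x + v + k (x + v) *s c \<in> W"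
      using W(2) by (auto simp: pline_def pt_subset_iff)
    have "(x + v + k (x + v) *s c) - (x + k x *s c) - v \<in> W"
      by (intro vec.subspace_diff W(2) mem)
    hence "(k (x + v) - k x) *s c \<in> W"
      by (simp add: vec.scale_left_diff_distrib algebra_simps)
    hence "inverse (k (x + v) - k x) *s ((k (x + v) - k x) *s c) \<in> W"
      by (rule vec.subspace_scale[OF W(2)])
    hence cW: "c \<in> W" using ne by simp
    have "c \<notin> pt v"
      using v c v0 pt_eq_iff[OF c(1) v0] by (metis vec.span_base singletonI)
    hence "vec.dim {c, v} = 2" using v0 by (simp add: vec.dim_insert)
    hence "vec.span {c, v} = U" if "vec.subspace U" "vec.dim U = 2" "c \<in> U" "v \<in> U" for U
      using that by (intro vec.subspace_dim_equal vec.span_minimal) auto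
    from this[OF W(2,3) cW mem(1)] this[OF sub dim2 cV v(1)] have "W = V" by simp
    hence "x + k x *s c \<in> V" using mem by blast
    moreover have "k x *s c \<in> V" using cV by (rule V_props(4))
    ultimately show False using affine_notin[OF x] by blast
  qed
  have "\<not> V \<subseteq> pt c"
  proof
    assume "V \<subseteq> pt c"
    hence "vec.dim V \<le> vec.dim (pt c)" by (rule vec.dim_subset)
    thus False using dim2 c by simp
  qed
  then obtain v' where v': "v' \<in> V" "v' \<notin> pt c" by blast
  have const: "k (p + v) = k p" if v: "v \<in> V" for v
  proof (cases "v \<in> pt c")
    case True
    have "v' - v \<notin> pt c" using v'(2) True vec.span_add[of "v' - v" "{c}" v] by auto
    hence "k (p + v + (v' - v)) = k (p + v)"
      using v v'(1) by (intro step affine_notin p V_props(3))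
    thus ?thesis using step[OF p v'] by simp
  qed (use step p v in blast)
  show ?thesis
    using k const affine_notin[OF p] cV V_props(4)
    by (intro bexI[of _ "k p *s c"]) auto
qed

section \<open>Counting the points of the line and the vectors on them\<close>

lemma card_V: "card V = CARD('a) ^ 2"
  using vec.card_subspace[OF _ _ sub] dim2 by simp

lemma card_ge_two: "2 \<le> CARD('a)"
proof -
  have "card {0, 1 :: 'a} \<le> CARD('a)" by (rule card_mono) auto
  thus ?thesis by simp
qed

text \<open>Each nonzero vector of \<open>T\<close> lies in exactly one point of the line. The
  subtracted 1 is always the zero vector, so no truncation occurs.\<close>

lemma sum_card_points:
  assumes "T \<subseteq> V" "0 \<in> T"
  shows "(\<Sum>P\<in>pline V. card (T \<inter> P) - 1) = card T - 1"
proof -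
  have zero: "0 \<in> P" if "P \<in> pline V" for P
    using that by (auto simp: pline_def pg_points_def vec.subspace_0)
  have "T - {0} = (\<Union>P\<in>pline V. T \<inter> P - {0})"
  proof (intro equalityI subsetI)
    fix x assume "x \<in> T - {0}"
    thus "x \<in> (\<Union>P\<in>pline V. T \<inter> P - {0})"
      using assms(1) sub by (intro UN_I[of "pt x"]) (auto simp: pt_in_pline_iff vec.span_base)
  qed auto
  moreover have "card (\<Union>P\<in>pline V. T \<inter> P - {0}) = (\<Sum>P\<in>pline V. card (T \<inter> P - {0}))"
  proof (intro card_UN_disjoint ballI impI)
    fix P Q assume "P \<in> pline V" "Q \<in> pline V" "P \<noteq> Q"
    hence "x \<in> P \<Longrightarrow> x \<in> Q \<Longrightarrow> x = 0" for x
      using pt_eqI[of P x] pt_eqI[of Q x] by (auto simp: pline_def)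
    thus "(T \<inter> P - {0}) \<inter> (T \<inter> Q - {0}) = {}" by blast
  qed auto
  ultimately have "card (T - {0}) = (\<Sum>P\<in>pline V. card (T \<inter> P - {0}))" by simp
  moreover have "card (T \<inter> P - {0}) = card (T \<inter> P) - 1" if "P \<in> pline V" for P
    using assms(2) zero[OF that] by simp
  ultimately show ?thesis using assms(2) by simp
qed

text \<open>The case \<open>T = V\<close> of \<open>sum_card_points\<close>: every point contributes
  q - 1 to a total of q^2 - 1.\<close>

lemma card_line: "card (pline V) = CARD('a) + 1"
proof -
  have "card (V \<inter> P) - 1 = CARD('a) - 1" if "P \<in> pline V" for P
  proof -
    have "V \<inter> P = P" "vec.subspace P" "vec.dim P = 1"
      using that by (auto simp: pline_def pg_points_def)
    thus ?thesis using vec.card_subspace[of P] by simp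
  qed
  hence "card (pline V) * (CARD('a) - 1) = CARD('a) ^ 2 - 1"
    using sum_card_points[of V] V_props(1) card_V by simp
  also have "\<dots> = (CARD('a) + 1) * (CARD('a) - 1)"
    by (simp add: algebra_simps power2_eq_square)
  finally show ?thesis using card_ge_two by (metis mult_cancel2 diff_is_0_eq not_less_eq_eq numeral_2_eq_2 One_nat_def)
qed

section \<open>Linear sets, line intersections and the affine part of a translation set\<close>

lemma \<B>_V: "\<B> V = pline V"
proof (intro equalityI subsetI)
  fix P assume "P \<in> \<B> V"
  then obtain v where "P \<in> pg_points" "v \<in> P" "v \<in> V" "v \<noteq> 0" by (auto simp: \<B>_def)
  thus "P \<in> pline V" using pt_eqI[of P v] pt_in_pline_iff[OF sub] by metis
next
  fix P assume P: "P \<in> pline V"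
  then obtain x where "x \<noteq> 0" "P = pt x" using pg_point_obtain by (auto simp: pline_def)
  thus "P \<in> \<B> V" using P by (auto simp: \<B>_def pline_def intro!: bexI[of _ x] vec.span_base)
qed

lemma \<B>_subset: "T \<subseteq> V \<Longrightarrow> \<B> T \<subseteq> pline V"
  using \<B>_V by (auto simp: \<B>_def)

lemma \<B>_iff:
  assumes "0 \<in> T" "P \<in> pline V"
  shows "P \<in> \<B> T \<longleftrightarrow> card (T \<inter> P) \<noteq> 1"
proof -
  have 0: "0 \<in> T \<inter> P" using assms by (auto simp: pline_def pg_points_def vec.subspace_0)
  have "card (T \<inter> P) = 1 \<longleftrightarrow> T \<inter> P = {0}"
    using 0 by (metis card_1_singletonE is_singletonI is_singleton_altdef singletonD)
  thus ?thesis using 0 assms(2) by (auto simp: \<B>_def pline_def)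
qed

text \<open>The line through \<open>pt (u + t)\<close> with direction \<open>v\<close> meets the
  line of \<open>V\<close> only in \<open>pt v\<close>. Since \<open>T\<close> is a group, its
  points coming from \<open>u + T\<close> are those of \<open>u + t + w\<close> with
  \<open>w\<close> in \<open>T \<inter> pt v\<close>. Each secant size is thereby read off from a
  single point of the line of \<open>V\<close>.\<close>

lemma card_secant:
  assumes T: "T \<subseteq> V" "\<And>x y. x \<in> T \<Longrightarrow> y \<in> T \<Longrightarrow> x - y \<in> T"
    and D: "D \<subseteq> pline V" and u: "u \<notin> V" and t: "t \<in> T" and v: "v \<in> V" "v \<noteq> 0"
  shows "card (((\<lambda>w. pt (u + w)) ` T \<union> D) \<inter> pline (vec.span {v, u + t})) =
    card (T \<inter> pt v) + (if pt v \<in> D then 1 else 0)"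
proof -
  let ?x = "u + t" and ?W = "vec.span {v, u + t}"
  have tV: "t \<in> V" and x: "?x \<notin> V" using t T(1) affine_notin u by blast+
  \<comment> \<open>Sums come from differences: \<open>a + b = a - ((b - b) - b)\<close>.\<close>
  have Tadd: "a + b \<in> T" if "a \<in> T" "b \<in> T" for a b
    using T(2)[OF that(1) T(2)[OF T(2)[OF that(2) that(2)] that(2)]] by simp
  have ptv: "pt v \<in> pline ?W" "pt v \<in> pline V"
    using v sub by (auto simp: pt_in_pline_iff vec.span_base)
  have "((\<lambda>w. pt (u + w)) ` T) \<inter> pline ?W = (\<lambda>w. pt (?x + w)) ` (T \<inter> pt v)"
  proof (intro equalityI subsetI)
    fix P assume "P \<in> ((\<lambda>w. pt (u + w)) ` T) \<inter> pline ?W"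
    then obtain w where w: "w \<in> T" "P = pt (u + w)" "P \<in> pline ?W" by blast
    hence "u + w \<in> ?W" by (auto simp: pline_def pt_subset_iff)
    then obtain a b where ab: "u + w = a *s v + b *s ?x" by (auto simp: in_join_iff)
    have "b *s ?x - ?x = (w - t) - a *s v" using ab by (simp add: algebra_simps)
    also have "\<dots> \<in> V" using w(1) T(1) tV v by (intro V_props(3,4)) auto
    finally have "b = 1" by (rule affine_coefficient[OF x])
    hence "w - t = a *s v" using ab by (simp add: algebra_simps)
    hence "w - t \<in> T \<inter> pt v" using T(2)[OF w(1) t] by (auto simp: in_pt_iff)
    thus "P \<in> (\<lambda>w. pt (?x + w)) ` (T \<inter> pt v)"
      using w(2) by (intro image_eqI[of _ _ "w - t"]) auto
  next
    fix P assume "P \<in> (\<lambda>w. pt (?x + w)) ` (T \<inter> pt v)"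
    then obtain w where w: "w \<in> T" "w \<in> pt v" "P = pt (?x + w)" by blast
    have wW: "w \<in> ?W" using w(2) by (rule vec.span_mono[THEN subsetD, rotated]) auto
    have "?x + w \<in> ?W" by (intro vec.span_add wW vec.span_base) auto
    hence "P \<in> pline ?W"
      using affine_pt[OF x, of w] w T(1) by (auto simp: pline_def pt_subset_iff)
    thus "P \<in> ((\<lambda>w. pt (u + w)) ` T) \<inter> pline ?W"
      using image_eqI[of P "\<lambda>w. pt (u + w)" "t + w" T] w(3) Tadd[OF t w(1)]
      by (simp add: add.assoc)
  qed
  moreover have "D \<inter> pline ?W = D \<inter> {pt v}"
  proof -
    have "P = pt v" if P: "P \<in> pline V" "P \<in> pline ?W" for P
    proof -
      obtain d where d: "d \<noteq> 0" "P = pt d" using pg_point_obtain P by (auto simp: pline_def)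
      have dV: "d \<in> V" "d \<in> ?W" using P d sub by (auto simp: pt_in_pline_iff)
      then obtain a b where ab: "d = a *s v + b *s ?x" by (auto simp: in_join_iff)
      have "b *s ?x = d - a *s v" using ab by simp
      also have "\<dots> \<in> V" using dV v by (intro V_props(3,4)) auto
      finally have "b = 0" by (simp add: scale_in_iff[OF x])
      hence "d \<in> pt v" using ab by (auto simp: in_pt_iff)
      thus ?thesis using d v pt_eq_iff by blast
    qed
    thus ?thesis using D ptv by blast
  qed
  ultimately have eq: "((\<lambda>w. pt (u + w)) ` T \<union> D) \<inter> pline ?W =
      (\<lambda>w. pt (?x + w)) ` (T \<inter> pt v) \<union> (D \<inter> {pt v})"
    by blast
  have "inj_on (\<lambda>w. pt (?x + w)) (T \<inter> pt v)"
    using affine_pt_inj[OF x] T(1) by (intro inj_onI) blast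
  moreover have "(\<lambda>w. pt (?x + w)) ` (T \<inter> pt v) \<inter> (D \<inter> {pt v}) = {}"
    using affine_pt_notin[OF x] T(1) D by blast
  ultimately show ?thesis
    unfolding eq by (subst card_Un_disjoint) (auto simp: card_image)
qed

text \<open>The direction arises by projecting a second point of the line into \<open>V\<close>
  along \<open>x\<close>. Hence \<open>card_secant\<close> covers every line through a point
  \<open>pt (u + t)\<close> with \<open>t\<close> in \<open>T\<close>.\<close>

lemma line_through_affine_point:
  assumes "vec.subspace W" "vec.dim W = 2" "x \<in> W" "x \<notin> V"
  shows "\<exists>v\<in>V - {0}. W = vec.span {v, x}"
proof -
  have "\<not> W \<subseteq> pt x"
  proof
    assume "W \<subseteq> pt x"
    hence "vec.dim W \<le> vec.dim (pt x)" by (rule vec.dim_subset)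
    thus False using assms(2) by (simp split: if_splits)
  qed
  then obtain z where z: "z \<in> W" "z \<notin> pt x" by blast
  obtain a where a: "z - a *s x \<in> V" using decomposition[OF assms(4)] by blast
  have ne: "z - a *s x \<noteq> 0" using z(2) by (auto simp: in_pt_iff)
  have "z - a *s x \<in> W" using assms(1,3) z(1) by (simp add: vec.subspace_diff vec.subspace_scale)
  hence "vec.span {z - a *s x, x} \<subseteq> W" using assms by (intro vec.span_minimal) auto
  hence "vec.span {z - a *s x, x} = W"
    using dim_join[OF a ne assms(4)] assms(1,2) by (intro vec.subspace_dim_equal) auto
  thus ?thesis using a ne by blast
qed

text \<open>An elation that stabilises \<open>A\<close> and takes \<open>pt (u + y)\<close> to
  \<open>pt u\<close> is the translation by \<open>- y\<close>. It takes \<open>pt (u + x)\<close>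
  to \<open>pt (u + (x - y))\<close>, which therefore lies in \<open>A\<close> again.\<close>

lemma translation_set_affine_part:
  assumes tr: "translation_set (pline V) A" and u: "u \<notin> V" "pt u \<in> A"
  shows "\<exists>T\<subseteq>V. 0 \<in> T \<and> (\<forall>x\<in>T. \<forall>y\<in>T. x - y \<in> T) \<and>
    A = (\<lambda>w. pt (u + w)) ` T \<union> (A \<inter> pline V)"
proof (intro exI[of _ "{v \<in> V. pt (u + v) \<in> A}"] conjI ballI)
  show "0 \<in> {v \<in> V. pt (u + v) \<in> A}" using u V_props(1) by simp
next
  fix x y assume x: "x \<in> {v \<in> V. pt (u + v) \<in> A}" and y: "y \<in> {v \<in> V. pt (u + v) \<in> A}"
  have "pt (u + y) \<in> A - pline V" "pt u \<in> A - pline V"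
    using y u affine_pt_notin[OF u(1)] V_props(1) affine_pt_notin[OF u(1), of 0] by auto
  then obtain \<phi> where \<phi>: "\<phi> \<in> elations (pline V)" "\<phi> ` A = A" "\<phi> (pt (u + y)) = pt u"
    using tr unfolding translation_set_def by blast
  obtain w where w: "w \<in> V" "\<And>v. v \<in> V \<Longrightarrow> \<phi> (pt (u + v)) = pt (u + v + w)"
    using elation_translation[OF \<phi>(1) u(1)] by blast
  have "pt (u + (y + w)) = pt (u + 0)"
    using w(2)[of y] y \<phi>(3) by (simp add: add.assoc)
  hence "y + w = 0"
    using affine_pt_inj[OF u(1)] y w(1) V_props(1,2) by blast
  hence "w = - y" by (simp add: eq_neg_iff_add_eq_0 add.commute)
  hence "\<phi> (pt (u + x)) = pt (u + (x - y))"
    using w(2)[of x] x by (simp add: algebra_simps)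
  moreover have "\<phi> (pt (u + x)) \<in> A" using x \<phi>(2) by blast
  ultimately show "x - y \<in> {v \<in> V. pt (u + v) \<in> A}"
    using x y V_props(3) by simp
next
  have "P \<in> (\<lambda>w. pt (u + w)) ` {v \<in> V. pt (u + v) \<in> A}" if "P \<in> A" "P \<notin> pline V" for P
    using affine_point[OF _ that(2) u(1)] that(1) tr by (auto simp: translation_set_def)
  thus "A = (\<lambda>w. pt (u + w)) ` {v \<in> V. pt (u + v) \<in> A} \<union> (A \<inter> pline V)" by blast
qed auto

section \<open>The club and the cone over it\<close>

lemma rank_V:
  assumes q: "CARD('a) = 2 ^ h"
  shows "f2_subspace_of_rank (2 * h) V"
proof -
  have "card V = 2 ^ (2 * h)" using card_V q by (simp add: mult.commute power_mult)
  thus ?thesis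
    using V_props(1,3) by (simp add: f2_subspace_of_rank_iff[OF q] f2_subspace_iff[OF q])
qed

text \<open>Let m be the number of points with intersection \<open>2 ^ i\<close>. Counting nonzero
  vectors gives \<open>card (\<B> T)\<close> + m (2^i - 2) = q - 1, and \<open>card (\<B> T)\<close>
  = q + 1 - 2^i, so m = 1 once 2^i - 2 is nonzero. For \<open>i = 1\<close> both sizes coincide and
  any point of \<open>\<B> T\<close> can be the head.\<close>

lemma club_head:
  assumes T: "T \<subseteq> V" "0 \<in> T" "card T = CARD('a)"
    and card_D: "card (pline V - \<B> T) = 2 ^ i" and i: "1 \<le> i"
    and sizes: "\<And>P. P \<in> \<B> T \<Longrightarrow> card (T \<inter> P) = 2 \<or> card (T \<inter> P) = 2 ^ i"
  shows "\<exists>N\<in>\<B> T. card (T \<inter> N) = 2 ^ i \<and> (\<forall>P\<in>\<B> T - {N}. card (T \<inter> P) = 2)"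
proof -
  have fin: "finite (\<B> T)" by simp
  have "(\<Sum>P\<in>\<B> T. card (T \<inter> P) - 1) = (\<Sum>P\<in>pline V. card (T \<inter> P) - 1)"
    using \<B>_iff[OF T(2)] \<B>_subset[OF T(1)] by (intro sum.mono_neutral_left) auto
  hence S: "(\<Sum>P\<in>\<B> T. card (T \<inter> P) - 1) = CARD('a) - 1"
    using sum_card_points[OF T(1,2)] T(3) by simp
  show ?thesis
  proof (cases "i = 1")
    case True
    have "\<B> T \<noteq> {}" using S card_ge_two by auto
    thus ?thesis using True sizes by auto
  next
    case False
    hence "(2::nat) ^ 2 \<le> 2 ^ i" using i by (intro power_increasing) auto
    hence t: "4 \<le> (2::nat) ^ i" by simp
    define M where "M = {P \<in> \<B> T. card (T \<inter> P) = 2 ^ i}"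
    \<comment> \<open>Every point contributes 1, and a point of \<open>M\<close> contributes
      \<open>2 ^ i - 2\<close> more.\<close>
    have "(\<Sum>P\<in>\<B> T. card (T \<inter> P) - 1) = (\<Sum>P\<in>\<B> T. 1 + (if P \<in> M then 2 ^ i - 2 else 0))"
      using t by (intro sum.cong) (auto simp: M_def dest: sizes)
    also have "\<dots> = card (\<B> T) + card M * (2 ^ i - 2)"
    proof -
      have "\<B> T \<inter> M = M" by (auto simp: M_def)
      thus ?thesis unfolding sum.distrib by (simp add: sum.If_cases)
    qed
    finally have "card (\<B> T) + card M * (2 ^ i - 2) = CARD('a) - 1" using S by simp
    moreover have "card (\<B> T) + 2 ^ i = CARD('a) + 1"
      using card_D card_line card_Diff_subset[OF fin \<B>_subset[OF T(1)]]
        card_mono[OF _ \<B>_subset[OF T(1)]] by simp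
    ultimately have "card M * (2 ^ i - 2) = 1 * (2 ^ i - 2)"
      using t card_ge_two by linarith
    hence "card M = 1" using t by (subst (asm) mult_cancel2) auto
    then obtain N where "M = {N}" by (auto simp: card_1_singleton_iff)
    thus ?thesis using sizes by (auto simp: M_def)
  qed
qed

text \<open>In characteristic 2 the set \<open>{0, u}\<close> is a group, so adjoining the coset
  \<open>u + T\<close> gives a group of twice the order.\<close>

lemma cone_rank:
  assumes q: "CARD('a) = 2 ^ h"
    and T: "T \<subseteq> V" "0 \<in> T" "\<And>x y. x \<in> T \<Longrightarrow> y \<in> T \<Longrightarrow> x - y \<in> T" "card T = 2 ^ k"
    and u: "u \<notin> V"
  shows "f2_subspace_of_rank (k + 1) (T \<union> (+) u ` T)"
proof -
  have "T \<inter> (+) u ` T = {}" using T(1) affine_notin[OF u] by blast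
  hence "card (T \<union> (+) u ` T) = 2 ^ (k + 1)"
    using T(4) by (simp add: card_Un_disjoint card_image)
  moreover have "x - y \<in> T \<union> (+) u ` T"
    if xy: "x \<in> T \<union> (+) u ` T" "y \<in> T \<union> (+) u ` T" for x y
  proof -
    have split: "\<exists>a v. a \<in> {0, u} \<and> z = a + v \<and> v \<in> T" if "z \<in> T \<union> (+) u ` T" for z
      using that by (metis UnE add_0 image_iff insertCI)
    obtain a v where a: "a \<in> {0, u}" "x = a + v" "v \<in> T" using xy(1) split[of x] by blast
    obtain b w where b: "b \<in> {0, u}" "y = b + w" "w \<in> T" using xy(2) split[of y] by blast
    have "a - b \<in> {0, u}" using a(1) b(1) char_two_minus[OF q, of 0 u] by auto
    moreover have "x - y = (a - b) + (v - w)" using a b by simp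
    ultimately show ?thesis using T(3)[OF a(3) b(3)] by auto
  qed
  ultimately show ?thesis
    using T(2) by (auto simp: f2_subspace_of_rank_iff[OF q] f2_subspace_iff[OF q])
qed

lemma \<B>_cone:
  assumes "T \<subseteq> V" "u \<notin> V"
  shows "\<B> (T \<union> (+) u ` T) - \<B> T = (\<lambda>w. pt (u + w)) ` T"
proof (intro equalityI subsetI)
  fix P assume "P \<in> \<B> (T \<union> (+) u ` T) - \<B> T"
  then obtain w where "w \<in> T" "u + w \<in> P" "u + w \<noteq> 0" "P \<in> pg_points"
    by (auto simp: \<B>_def)
  thus "P \<in> (\<lambda>w. pt (u + w)) ` T" using pt_eqI by blast
next
  fix P assume "P \<in> (\<lambda>w. pt (u + w)) ` T"
  then obtain w where w: "w \<in> T" "P = pt (u + w)" by blast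
  have wV: "w \<in> V" using w assms by blast
  have "P \<notin> \<B> T" using affine_pt_notin[OF assms(2) wV] \<B>_subset[OF assms(1)] w by blast
  moreover have "u + w \<noteq> 0" using affine_notin[OF assms(2) wV] V_props(1) by metis
  ultimately show "P \<in> \<B> (T \<union> (+) u ` T) - \<B> T"
    using w affine_pt[OF assms(2) wV] vec.span_base[of "u + w" "{u + w}"] by (auto simp: \<B>_def)
qed

section \<open>Every translation KM-arc comes from a club\<close>

lemma translation_km_arc_club:
  assumes q: "CARD('a) = 2 ^ h" and i: "1 \<le> i" and km: "km_arc (2 ^ i) A"
    and tr: "translation_set (pline V) A" and ih: "i = h \<Longrightarrow> A \<inter> pline V \<noteq> {}"
  shows "\<exists>\<mu> N \<pi>. club_construction h i (pline V) V \<mu> N \<pi> A"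
proof -
  have card_A: "card A = CARD('a) + 2 ^ i" and A: "A \<subseteq> pg_points"
    and secants: "\<And>L. L \<in> pg_lines \<Longrightarrow> card (A \<inter> L) \<in> {0, 2, 2 ^ i}"
    using km by (auto simp: km_arc_def)
  have even: "even ((2::nat) ^ i)" and t2: "(2::nat) \<le> 2 ^ i"
    using i power_increasing[of 1 i "2::nat"] by auto
  obtain L where L: "L \<in> pg_lines" "card (A \<inter> L) = 2 ^ i"
    using km by (auto simp: km_arc_def)
  then obtain W where W: "plane_line W" "L = pline W"
    by (auto simp: pg_lines_iff plane_line_def)
  \<comment> \<open>A \<open>2 ^ i\<close>-secant has only q + 1 points; this bounds
    \<open>i\<close> by \<open>h\<close>.\<close>
  have "(2::nat) ^ i \<le> 2 ^ h + 1"
    using card_mono[of L "A \<inter> L"] L W plane_line.card_line[OF W(1)] q by simp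
  hence "(2::nat) ^ i < 2 ^ Suc h" using q card_ge_two by simp
  hence i_le: "i \<le> h" by (metis less_Suc_eq_le power_less_imp_less_exp one_less_numeral_iff semiring_norm(76))
  \<comment> \<open>Otherwise the line would meet \<open>A\<close> in q + 2^i points, more than any
    permitted number.\<close>
  have "\<not> A \<subseteq> pline V"
  proof
    assume "A \<subseteq> pline V"
    hence "A \<inter> pline V = A" by blast
    thus False using secants[OF line] card_A card_ge_two t2 by auto
  qed
  then obtain P where P: "P \<in> A" "P \<notin> pline V" by blast
  then obtain u where u0: "u \<noteq> 0" "P = pt u" using A pg_point_obtain by blast
  have u: "u \<notin> V" "pt u \<in> A" using P u0 sub pt_in_pline_iff by blast+
  obtain T where T: "T \<subseteq> V" "0 \<in> T" "\<And>x y. x \<in> T \<Longrightarrow> y \<in> T \<Longrightarrow> x - y \<in> T"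
    and A_eq: "A = (\<lambda>w. pt (u + w)) ` T \<union> (A \<inter> pline V)"
    using translation_set_affine_part[OF tr u] by blast
  have T_sub: "module.subspace f2_scale T" using T by (simp add: f2_subspace_iff[OF q])
  have inj: "inj_on (\<lambda>w. pt (u + w)) T"
    using affine_pt_inj[OF u(1)] T(1) by (intro inj_onI) blast
  have disj: "(\<lambda>w. pt (u + w)) ` T \<inter> (A \<inter> pline V) = {}"
    using affine_pt_notin[OF u(1)] T(1) by blast
  have "card A = card ((\<lambda>w. pt (u + w)) ` T) + card (A \<inter> pline V)"
    by (subst A_eq, rule card_Un_disjoint[OF _ _ disj]) auto
  hence "2 ^ h + 2 ^ i = 2 ^ f2_dim T + card (A \<inter> pline V)"
    using card_A q card_image[OF inj] card_f2_subspace[OF q T_sub] by simp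
  moreover have "i = h \<Longrightarrow> card (A \<inter> pline V) \<noteq> 0" using ih by simp
  ultimately have card_D: "card (A \<inter> pline V) = 2 ^ i" and "f2_dim T = h"
    using power_of_two_partition[OF _ secants[OF line] i i_le] by blast+
  hence card_T: "card T = 2 ^ h" using card_f2_subspace[OF q T_sub] by simp
  have secant: "card (T \<inter> P) + (if P \<in> A then 1 else 0) \<in> {2, 2 ^ i}" if P: "P \<in> pline V" for P
  proof -
    obtain v where v: "v \<noteq> 0" "P = pt v" using pg_point_obtain P by (auto simp: pline_def)
    have vV: "v \<in> V" using P v sub pt_in_pline_iff by blast
    \<comment> \<open>Written with \<open>u + 0\<close> so that \<open>card_secant\<close> applies
      with \<open>t = 0\<close>.\<close>
    have "pline (vec.span {v, u + 0}) \<in> pg_lines"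
      using dim_join[OF vV v(1) u(1)] by (auto simp: pg_lines_iff)
    hence "card (A \<inter> pline (vec.span {v, u + 0})) \<in> {0, 2, 2 ^ i}" by (rule secants)
    moreover have "card (A \<inter> pline (vec.span {v, u + 0})) =
        card (T \<inter> P) + (if P \<in> A \<inter> pline V then 1 else 0)"
      using card_secant[OF T(1,3) _ u(1) T(2) vV v(1), of "A \<inter> pline V"] v(2)
      unfolding A_eq[symmetric] by simp
    ultimately have "card (T \<inter> P) + (if P \<in> A \<inter> pline V then 1 else 0) \<in> {0, 2, 2 ^ i}"
      by (simp only:)
    \<comment> \<open>The zero vector stands for the point \<open>pt u\<close> of this line, so the
      value 0 is impossible.\<close>
    moreover have "0 \<in> T \<inter> P" using T(2) v(2) vec.span_zero by blast
    hence "card (T \<inter> P) \<noteq> 0" by auto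
    ultimately show ?thesis using P by auto
  qed
  have power: "card (T \<inter> P) = 2 ^ weight T P" if "P \<in> pline V" for P
    using card_eq_power_weight[OF q T(2,3)] that by (auto simp: pline_def)
  have A_iff: "P \<in> A \<longleftrightarrow> P \<notin> \<B> T" if P: "P \<in> pline V" for P
  proof
    assume "P \<in> A"
    hence "card (T \<inter> P) + 1 \<in> {2, 2 ^ i}" using secant[OF P] by simp
    \<comment> \<open>Both permitted sizes are even as \<open>1 \<le> i\<close>, and the only odd
      power of two is 1.\<close>
    hence "even (card (T \<inter> P) + 1)" using even by (metis dvd_refl insertE singletonD)
    hence "odd (card (T \<inter> P))" by simp
    hence "card (T \<inter> P) = 1" using power[OF P] by (cases "weight T P") auto
    thus "P \<notin> \<B> T" using \<B>_iff[OF T(2) P] by simp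
  next
    \<comment> \<open>The intersection has size 1, which is not a permitted secant size, so
      \<open>P\<close> itself must supply the missing point.\<close>
    assume "P \<notin> \<B> T"
    hence "card (T \<inter> P) = 1" using \<B>_iff[OF T(2) P] by simp
    thus "P \<in> A" using secant[OF P] t2 by (auto split: if_splits)
  qed
  hence D: "pline V - \<B> T = A \<inter> pline V" by blast
  have "card (T \<inter> P) = 2 \<or> card (T \<inter> P) = 2 ^ i" if P: "P \<in> \<B> T" for P
  proof -
    have PV: "P \<in> pline V" using P \<B>_subset[OF T(1)] by blast
    thus ?thesis using secant[OF PV] A_iff[OF PV] P by simp
  qed
  moreover have "card T = CARD('a)" "card (pline V - \<B> T) = 2 ^ i"
    using card_T card_D q D by simp_all
  ultimately obtain N where N: "N \<in> \<B> T" "card (T \<inter> N) = 2 ^ i"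
    "\<And>P. P \<in> \<B> T - {N} \<Longrightarrow> card (T \<inter> P) = 2"
    using club_head[OF T(1,2) _ _ i] by blast
  have NV: "N \<in> pline V" using N(1) \<B>_subset[OF T(1)] by blast
  have "weight T N = i" using N(2) power[OF NV] by simp
  moreover have "weight T P = 1" if "P \<in> \<B> T - {N}" for P
  proof -
    have "2 ^ weight T P = (2::nat) ^ 1" using N(3)[OF that] power[of P] that \<B>_subset[OF T(1)] by auto
    thus ?thesis by (rule power_inject_exp[THEN iffD1, rotated]) simp
  qed
  ultimately have "is_club i h T N"
    using N(1) T_sub card_T by (auto simp: is_club_def f2_subspace_of_rank_iff[OF q])
  moreover have "(T \<union> (+) u ` T) \<inter> V = T" using T(1) affine_notin[OF u(1)] by blast
  ultimately have "club_construction h i (pline V) V T N (T \<union> (+) u ` T) A"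
    unfolding club_construction_def \<B>_cone[OF T(1) u(1)] D
    using rank_V[OF q] \<B>_V T(1) NV cone_rank[OF q T card_T u(1)] A_eq by simp
  thus ?thesis by blast
qed

section \<open>The head is the nucleus\<close>

lemma club_construction_nucleus:
  assumes q: "CARD('a) = 2 ^ h" and i: "1 < i" and km: "km_arc (2 ^ i) A"
    and club: "club_construction h i (pline V) V T N \<pi> A"
  shows "is_nucleus (2 ^ i) A N"
proof -
  have card_A: "card A = CARD('a) + 2 ^ i"
    and secants: "\<And>L. L \<in> pg_lines \<Longrightarrow> card (A \<inter> L) \<in> {0, 2, 2 ^ i}"
    using km by (auto simp: km_arc_def)
  have t4: "4 \<le> (2::nat) ^ i" using i power_increasing[of 2 i "2::nat"] by simp
  have T: "T \<subseteq> V" "0 \<in> T" "\<And>x y. x \<in> T \<Longrightarrow> y \<in> T \<Longrightarrow> x - y \<in> T" and card_T: "card T = 2 ^ h"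
    and N: "N \<in> \<B> T" "N \<in> pline V" "weight T N = i"
    and w1: "\<And>P. P \<in> \<B> T - {N} \<Longrightarrow> weight T P = 1"
    and \<pi>: "card \<pi> = 2 ^ (h + 1)" "\<And>x y. x \<in> \<pi> \<Longrightarrow> y \<in> \<pi> \<Longrightarrow> x - y \<in> \<pi>" "\<pi> \<inter> V = T"
    and A_eq: "A = (\<B> \<pi> - \<B> T) \<union> (pline V - \<B> T)"
    using club by (auto simp: club_construction_def is_club_def f2_subspace_of_rank_iff[OF q]
        f2_subspace_iff[OF q])
  have "\<pi> \<noteq> T" using \<pi>(1) card_T by auto
  \<comment> \<open>Any vector of \<open>\<pi>\<close> outside \<open>V\<close> can serve as apex:
    the cone it spans with \<open>T\<close> lies in \<open>\<pi>\<close> and has the same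
    order.\<close>
  then obtain u where u\<pi>: "u \<in> \<pi>" and u: "u \<notin> V" using \<pi>(3) by blast
  have "T \<union> (+) u ` T = \<pi>"
  proof (rule card_subset_eq)
    have "u + w \<in> \<pi>" if "w \<in> T" for w
      using \<pi>(2)[OF u\<pi>, of w] that \<pi>(3) char_two_minus[OF q, of u w] by auto
    thus "T \<union> (+) u ` T \<subseteq> \<pi>" using \<pi>(3) by auto
    show "card (T \<union> (+) u ` T) = card \<pi>"
      using cone_rank[OF q T card_T u] \<pi>(1) by (simp add: f2_subspace_of_rank_iff[OF q])
  qed simp
  hence A: "A = (\<lambda>w. pt (u + w)) ` T \<union> (pline V - \<B> T)"
    using A_eq \<B>_cone[OF T(1) u] by simp
  have power: "card (T \<inter> P) = 2 ^ weight T P" if "P \<in> pline V" for P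
    using card_eq_power_weight[OF q T(2,3)] that by (auto simp: pline_def)
  \<comment> \<open>A point of weight 0 counts 1 and adds itself, a point of weight 1 counts 2, and
    the head counts \<open>2 ^ i\<close>.\<close>
  have secant: "card (A \<inter> pline (vec.span {v, u + w})) = (if pt v = N then 2 ^ i else 2)"
    if w: "w \<in> T" and v: "v \<in> V" "v \<noteq> 0" for v w
  proof -
    have P: "pt v \<in> pline V" using v sub by (simp add: pt_in_pline_iff)
    have "card (A \<inter> pline (vec.span {v, u + w})) =
        card (T \<inter> pt v) + (if pt v \<in> pline V - \<B> T then 1 else 0)"
      unfolding A by (rule card_secant[OF T(1,3) Diff_subset u w v])
    thus ?thesis
      using power[OF P] w1[of "pt v"] N \<B>_iff[OF T(2) P] P by (cases "pt v \<in> \<B> T") auto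
  qed
  obtain n where n: "n \<noteq> 0" "N = pt n" using N(2) pg_point_obtain by (auto simp: pline_def)
  have nV: "n \<in> V" using n N(2) sub pt_in_pline_iff by blast
  have N_secant: "pline (vec.span {n, u + w}) \<in> pg_lines"
    "card (A \<inter> pline (vec.span {n, u + w})) = 2 ^ i" "N \<in> pline (vec.span {n, u + w})"
    "pt (u + w) \<in> pline (vec.span {n, u + w})" if w: "w \<in> T" for w
  proof -
    have x: "u + w \<notin> V" using affine_notin[OF u] w T(1) by blast
    have x0: "u + w \<noteq> 0" using x V_props(1) by metis
    show "pline (vec.span {n, u + w}) \<in> pg_lines"
      using dim_join[OF nV n(1) x] by (auto simp: pg_lines_iff)
    show "card (A \<inter> pline (vec.span {n, u + w})) = 2 ^ i"
      using secant[OF w nV n(1)] n(2) by simp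
    show "N \<in> pline (vec.span {n, u + w})" "pt (u + w) \<in> pline (vec.span {n, u + w})"
      using n x0 by (simp_all add: pt_in_pline_iff vec.span_base)
  qed
  have N_in: "N \<in> L" if L: "L \<in> pg_lines" "card (A \<inter> L) = 2 ^ i" for L
  proof -
    obtain W where W: "L = pline W" "vec.subspace W" "vec.dim W = 2"
      using L by (auto simp: pg_lines_iff)
    show ?thesis
    proof (cases "\<exists>w\<in>T. pt (u + w) \<in> L")
      case True
      then obtain w where w: "w \<in> T" "pt (u + w) \<in> L" by blast
      have x: "u + w \<notin> V" using affine_notin[OF u] w T(1) by blast
      have "pt (u + w) \<subseteq> W" using w(2) W(1) by (simp add: pline_def)
      hence "u + w \<in> W" by (simp only: pt_subset_iff[OF W(2)])
      then obtain v where v: "v \<in> V" "v \<noteq> 0" "W = vec.span {v, u + w}"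
        using line_through_affine_point[OF W(2,3) _ x] by blast
      have "card (A \<inter> L) = (if pt v = N then 2 ^ i else 2)"
        using secant[OF w(1) v(1,2)] unfolding W(1) v(3) .
      hence "pt v = N" using L(2) t4 by (simp split: if_splits)
      moreover have "v \<in> W" using v(3) vec.span_base by blast
      ultimately show ?thesis using pt_in_pline_iff[OF W(2) v(2)] W(1) by simp
    next
      \<comment> \<open>Without affine points of \<open>A\<close> on \<open>L\<close>, two of its
        points of \<open>A\<close> lie on the line of \<open>V\<close>. Then \<open>L\<close> is
        that line, which contains the head.\<close>
      case False
      hence sub_l: "A \<inter> L \<subseteq> pline V" using A by blast
      have "\<not> A \<inter> L \<subseteq> {P}" for P
      proof
        assume "A \<inter> L \<subseteq> {P}"
        hence "card (A \<inter> L) \<le> 1" using card_mono[of "{P}" "A \<inter> L"] by simp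
        thus False using L(2) t4 by simp
      qed
      note two = this
      \<comment> \<open>The instance at an arbitrary value serves only to show that the intersection
        is nonempty.\<close>
      obtain P where P: "P \<in> A \<inter> L" using two[of undefined] by auto
      obtain Q where Q: "Q \<in> A \<inter> L" "P \<noteq> Q" using two[of P] by auto
      have "P \<in> pline V" "Q \<in> pline V" using P Q(1) sub_l by (simp_all add: subset_iff)
      hence "L = pline V"
        using two_points_line[OF W(2,3) sub dim2 Q(2)] P Q(1) W(1) by simp
      thus ?thesis using N(2) by simp
    qed
  qed
  \<comment> \<open>A second common point would make all \<open>2 ^ i\<close>-secants equal to the
    line \<open>L\<close> joining it to \<open>N\<close>. As each affine point of \<open>A\<close>
    is on such a secant, \<open>A\<close> would lie on \<open>L\<close> and the line of
    \<open>V\<close>. The latter would then contain at least q points of \<open>A\<close>, be a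
    \<open>2 ^ i\<close>-secant itself and equal \<open>L\<close>, although \<open>pt u\<close> is
    off it.\<close>
  have "P = N" if P: "P \<in> pg_points" "\<And>L. L \<in> pg_lines \<Longrightarrow> card (A \<inter> L) = 2 ^ i \<Longrightarrow> P \<in> L" for P
  proof (rule ccontr)
    assume ne: "P \<noteq> N"
    define L where "L = pline (vec.span {n, u + 0})"
    have L: "L \<in> pg_lines" "card (A \<inter> L) = 2 ^ i" "N \<in> L" "pt u \<in> L"
      using N_secant[OF T(2)] by (simp_all add: L_def)
    have uniq: "L' = L" if L': "L' \<in> pg_lines" "card (A \<inter> L') = 2 ^ i" for L'
    proof -
      obtain W where W: "L = pline W" "vec.subspace W" "vec.dim W = 2"
        using L(1) unfolding pg_lines_iff by blast
      obtain W' where W': "L' = pline W'" "vec.subspace W'" "vec.dim W' = 2"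
        using L'(1) unfolding pg_lines_iff by blast
      show ?thesis
        using two_points_line[OF W'(2,3) W(2,3) ne] P(2)[OF L'] P(2)[OF L(1,2)] N_in[OF L'] L(3)
        unfolding W(1) W'(1) by blast
    qed
    have "A \<subseteq> (A \<inter> L) \<union> (A \<inter> pline V)"
      using A N_secant(1,2,4) uniq by blast
    hence "card A \<le> card (A \<inter> L) + card (A \<inter> pline V)"
      by (meson card_Un_le card_mono finite le_trans)
    hence q_le: "CARD('a) \<le> card (A \<inter> pline V)" using L(2) card_A by simp
    have "card (A \<inter> L) \<le> CARD('a) + 1"
    proof -
      obtain W where "plane_line W" "L = pline W"
        using L(1) by (auto simp: pg_lines_iff plane_line_def)
      thus ?thesis using card_mono[of L "A \<inter> L"] plane_line.card_line[of W] by simp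
    qed
    \<comment> \<open>This excludes the intersection sizes 0 and 2.\<close>
    hence "3 \<le> CARD('a)" using L(2) t4 by simp
    hence "card (A \<inter> pline V) = 2 ^ i" using secants[OF line] q_le by auto
    hence "pline V = L" by (intro uniq line)
    thus False using L(4) affine_pt_notin[OF u, of 0] V_props(1) by simp
  qed
  hence "{P \<in> pg_points. \<forall>L\<in>pg_lines. card (A \<inter> L) = 2 ^ i \<longrightarrow> P \<in> L} = {N}"
    using N_in N(2) by (auto simp: pline_def)
  thus ?thesis by (simp add: is_nucleus_def)
qed

end

text \<open>For \<open>i = h\<close> the symmetric difference of two lines is a translation KM-arc
  with respect to any third line through their common point, and it misses that line. A club of rank
  \<open>h\<close> with head of weight \<open>h\<close> is a single point, so the construction would
  put q points of \<open>l\<close> into \<open>A\<close>; the last assumption excludes this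
  case.\<close>

theorem theorem2p2:
  fixes A l :: "('a::{field,finite} ^ 3) set set" and h i :: nat
  assumes "CARD('a) = 2 ^ h"
    and "1 \<le> i"
    and "l \<in> pg_lines"
    and "km_arc (2 ^ i) A"
    and "translation_set l A"
    and "i = h \<longrightarrow> A \<inter> l \<noteq> {}"
  shows "(\<exists>H \<mu> N \<pi>. club_construction h i l H \<mu> N \<pi> A) \<and>
    (\<forall>H \<mu> N \<pi>. club_construction h i l H \<mu> N \<pi> A \<and> 1 < i \<longrightarrow> is_nucleus (2 ^ i) A N)"
proof -
  obtain V where V: "l = pline V" "vec.subspace V" "vec.dim V = 2"
    using assms(3) by (auto simp: pg_lines_iff)
  interpret plane_line V by unfold_locales (fact V)+
  \<comment> \<open>The second claim concerns every \<open>H\<close>, but \<open>\<B> H = l\<close>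
    forces \<open>H \<subseteq> V\<close> and the orders agree. So only \<open>V\<close> has to be
    considered.\<close>
  have H: "H = V" if "club_construction h i l H \<mu> N \<pi> A" for H \<mu> N \<pi>
  proof (rule card_subset_eq)
    have \<B>: "\<B> H = pline V" and card_H: "card H = 2 ^ (2 * h)"
      using that V(1) by (auto simp: club_construction_def f2_subspace_of_rank_iff[OF assms(1)])
    show "H \<subseteq> V"
    proof
      fix x assume x: "x \<in> H"
      show "x \<in> V"
      proof (cases "x = 0")
        case False
        hence "pt x \<in> \<B> H"
          using x by (auto simp: \<B>_def pt_in_pg_points intro!: bexI[of _ x] vec.span_base)
        thus ?thesis using \<B> False sub by (simp add: pt_in_pline_iff)
      qed (simp add: V_props(1))
    qed
    show "card H = card V"
      using card_H card_V assms(1) by (simp add: mult.commute power_mult)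
  qed simp
  show ?thesis
    using translation_km_arc_club[OF assms(1,2,4)] club_construction_nucleus[OF assms(1) _ assms(4)]
      assms(5,6) H V(1) by blast
qed

end
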